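(* Let $\mathcal{S}=\langle\mathcal{L},\vdash_\gamma\rangle$ and $\mathcal{T}=\langle\mathcal{L}',\vdash_\delta\rangle$ be two propositional deductive systems, with domains $S$ and $T$. If there exists a non-conservative interpretation of $\mathcal{S}$ in $\mathcal{T}$, then there exist a quantale homomorphism $\overline{\tau}:\wp(\mathbf{\Sigma}_{\mathcal{L}})\to\wp(\mathbf{\Sigma}_{\mathcal{L}'})$ and a homomorphism of $\wp(\mathbf{\Sigma}_{\mathcal{L}})$-modules $f:\wp(\mathbf{S})_\gamma\to\wp(\mathbf{T})_\delta$, where $\wp(\mathbf{T})_\delta$ is regarded as a $\wp(\mathbf{\Sigma}_{\mathcal{L}})$-module via $\overline{\tau}$.
   Context: A propositional language is $\mathcal{L}=\langle L,\nu\rangle$ with $L$ a set of connectives and $\nu:L\to\mathbb{N}_0$ the arity. Fix a denumerable set $V$ of variables common to all languages. $\mathit{Fm}_{\mathcal{L}}$ is the set of $\mathcal{L}$-formulas. A substitution is a map $V\to\mathit{Fm}_{\mathcal{L}}$ extended to formulas; $\mathbf{\Sigma}_{\mathcal{L}}$ is the monoid of substitutions under composition; $\wp(\mathbf{\Sigma}_{\mathcal{L}})$ is the quantale of sets of substitutions (join = union, complex product $\Sigma_1\cdot\Sigma_2=\{\sigma_1\circ\sigma_2\}$, unit $\{\mathrm{id}\}$). A sequent of type $(m,n)$ is a pair of sequences of $\mathcal{L}$-formulas of lengths $m$ and $n$ (not both zero). A set of sequents is assumed closed under type. Formulas are identified with $(0,1)$-sequents, equations with $(1,1)$-sequents. A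 deductive system $\mathcal{S}=\langle\mathcal{L},\vdash_\gamma\rangle$ has as domain a set $S$ of sequents over $\mathcal{L}$ closed under type, with a finitary, substitution-invariant consequence relation $\vdash_\gamma$ on $\wp(S)$: $\Psi\subseteq\Phi$ implies $\Phi\vdash\Psi$; $\vdash$ is transitive; $\Phi\vdash\bigcup_{\Phi\vdash\Psi}\Psi$; if $\Phi\vdash\Psi$ with $\Psi$ finite then $\Phi_0\vdash\Psi$ for some finite $\Phi_0\subseteq\Phi$; $\Phi\vdash\Psi$ implies $\sigma[\Phi]\vdash\sigma[\Psi]$. The associated closure operator is $\gamma(\Phi)=\bigcup\{\Psi\mid\Phi\vdash_\gamma\Psi\}$. $\wp(\mathbf{S})$ is the $\wp(\mathbf{\Sigma}_{\mathcal{L}})$-module of subsets of $S$ with $\Sigma\star\Phi=\{\sigma(\varphi)\mid\sigma\in\Sigma,\varphi\in\Phi\}$. $\wp(\mathbf{S})_\gamma$ is the module $\{\gamma(\Phi)\mid\Phi\subseteq S\}$ with join $\gamma(\bigcup_i\Phi_i)$ and scalar multiplication $\Sigma\star_\gamma\Phi=\gamma(\Sigma\star\Phi)$; similarly $\wp(\mathbf{T})_\delta$. An $\mathbf{R}$-module becomes a $\mathbf{Q}$-module via a quantale homomorphism $h:\mathbf{Q}\to\mathbf{R}$ by $q\star_hx=h(q)\star x$. Module homomorphisms preserve arbitrary joins and scalars. Language translation: a derived connective in $\mathcal{L}'$ of arity $n$ is a map $(\psi_1,\dots,\psi_n)\mapsto\varphi(x_1/\psi_1,\dots,x_n/\psi_n)$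 for some $\mathcal{L}'$-formula $\varphi(x_1,\dots,x_n)$. Given for each $f\in L$ a derived connective $f'$ in $\mathcal{L}'$ of arity $\nu(f)$, $\tau:\mathit{Fm}_{\mathcal{L}}\to\mathit{Fm}_{\mathcal{L}'}$ is a language translation if $\tau^{-1}(x)=\{x\}$ for every variable $x$ and $\tau(f(\varphi_1,\dots,\varphi_{\nu(f)}))=f'(\tau(\varphi_1),\dots,\tau(\varphi_{\nu(f)}))$. It induces the quantale homomorphism $\overline{\tau}$, the elementwise extension of the map sending $\sigma$ to the substitution whose restriction to $V$ is $\tau\circ\sigma_{\restriction V}$. A non-conservative interpretation of $\mathcal{S}$ in $\mathcal{T}$ is a map $\iota:\wp(S)\to\wp(T)$ preserving arbitrary unions for which there is a language translation $\tau$ of $\mathcal{L}$ in $\mathcal{L}'$ such that for all $\Phi,\Psi\in\wp(S)$ and all sets $\Sigma$ of substitutions over $\mathcal{L}$: (i) $\Phi\vdash_\gamma\Psi$ implies $\iota(\Phi)\vdash_\delta\iota(\Psi)$; (ii) $\iota(\Sigma\star\Phi)=\overline{\tau}(\Sigma)\star\iota(\Phi)$. *)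

theory Defs
  imports "HOL-Algebra.Complete_Lattice" "HOL-Algebra.Group"
begin

section \<open>Quantales and their modules\<close>

record 'a join_order = "'a gorder" +
  Join :: "'a set \<Rightarrow> 'a"

locale sup_lattice = complete_lattice L for L (structure) +
  assumes Join_lub: "A \<subseteq> carrier L \<Longrightarrow> is_lub L (Join L A) A"

record 'q quantale = "'q join_order" +
  qmult :: "'q \<Rightarrow> 'q \<Rightarrow> 'q"
  qone :: 'q

locale quantale = sup_lattice Q for Q (structure) +
  assumes qmonoid: "monoid \<lparr>carrier = carrier Q, mult = qmult Q, one = qone Q\<rparr>"
    and qmult_Join_left:
      "\<lbrakk>A \<subseteq> carrier Q; b \<in> carrier Q\<rbrakk> \<Longrightarrow> qmult Q (Join Q A) b = Join Q ((\<lambda>a. qmult Q a b) ` A)"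
    and qmult_Join_right:
      "\<lbrakk>A \<subseteq> carrier Q; b \<in> carrier Q\<rbrakk> \<Longrightarrow> qmult Q b (Join Q A) = Join Q ((\<lambda>a. qmult Q b a) ` A)"

record ('q, 'm) qmodule = "'m join_order" +
  act :: "'q \<Rightarrow> 'm \<Rightarrow> 'm"

locale quantale_module = scalar: quantale Q + sup_lattice M
  for Q :: "('q, 'b) quantale_scheme" and M :: "('q, 'm, 'c) qmodule_scheme" (structure) +
  assumes act_closed: "\<lbrakk>q \<in> carrier Q; x \<in> carrier M\<rbrakk> \<Longrightarrow> act M q x \<in> carrier M"
    and act_qone: "x \<in> carrier M \<Longrightarrow> act M (qone Q) x = x"
    and act_qmult:
      "\<lbrakk>p \<in> carrier Q; q \<in> carrier Q; x \<in> carrier M\<rbrakk> \<Longrightarrow> act M (qmult Q p q) x = act M p (act M q x)"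
    and act_Join_left:
      "\<lbrakk>A \<subseteq> carrier Q; x \<in> carrier M\<rbrakk> \<Longrightarrow> act M (Join Q A) x = Join M ((\<lambda>q. act M q x) ` A)"
    and act_Join_right:
      "\<lbrakk>q \<in> carrier Q; X \<subseteq> carrier M\<rbrakk> \<Longrightarrow> act M q (Join M X) = Join M (act M q ` X)"

locale quantale_hom = dom: quantale Q + cod: quantale R
  for Q :: "('q, 'b) quantale_scheme" and R :: "('r, 'c) quantale_scheme" and h :: "'q \<Rightarrow> 'r" +
  assumes hom_closed: "h \<in> carrier Q \<rightarrow> carrier R"
    and hom_Join: "A \<subseteq> carrier Q \<Longrightarrow> h (Join Q A) = Join R (h ` A)"
    and hom_qmult: "\<lbrakk>p \<in> carrier Q; q \<in> carrier Q\<rbrakk> \<Longrightarrow> h (qmult Q p q) = qmult R (h p) (h q)"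
    and hom_qone: "h (qone Q) = qone R"

locale quantale_module_hom = dom: quantale_module Q M + cod: quantale_module Q N
  for Q :: "('q, 'b) quantale_scheme"
    and M :: "('q, 'm, 'c) qmodule_scheme" and N :: "('q, 'n, 'd) qmodule_scheme"
    and f :: "'m \<Rightarrow> 'n" +
  assumes hom_closed: "f \<in> carrier M \<rightarrow> carrier N"
    and hom_Join: "X \<subseteq> carrier M \<Longrightarrow> f (Join M X) = Join N (f ` X)"
    and hom_act: "\<lbrakk>q \<in> carrier Q; x \<in> carrier M\<rbrakk> \<Longrightarrow> f (act M q x) = act N q (f x)"

definition restrict_scalars :: "('q \<Rightarrow> 'r) \<Rightarrow> ('r, 'm) qmodule \<Rightarrow> ('q, 'm) qmodule" where
  "restrict_scalars h N =
     \<lparr>carrier = carrier N, eq = eq N, le = le N, Join = Join N, act = (\<lambda>q x. act N (h q) x)\<rparr>"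


section \<open>Languages, formulas and substitutions\<close>

record 'f language =
  conns :: "'f set"
  arity :: "'f \<Rightarrow> nat"

text \<open>The denumerable set of variables common to all languages is the type \<^typ>\<open>nat\<close>.
  The datatype contains raw terms; the formulas of a language are those in \<open>fm L\<close>.\<close>

datatype 'f form = Var nat | App 'f "'f form list"

inductive_set fm :: "'f language \<Rightarrow> 'f form set" for L where
  fm_Var: "Var x \<in> fm L"
| fm_App: "\<lbrakk>f \<in> conns L; length \<phi>s = arity L f; \<And>\<phi>. \<phi> \<in> set \<phi>s \<Longrightarrow> \<phi> \<in> fm L\<rbrakk> \<Longrightarrow> App f \<phi>s \<in> fm L"

fun vars :: "'f form \<Rightarrow> nat set" where
  "vars (Var x) = {x}"
| "vars (App f \<phi>s) = (\<Union>\<phi>\<in>set \<phi>s. vars \<phi>)"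

fun subst :: "(nat \<Rightarrow> 'f form) \<Rightarrow> 'f form \<Rightarrow> 'f form" where
  "subst \<sigma> (Var x) = \<sigma> x"
| "subst \<sigma> (App f \<phi>s) = App f (map (subst \<sigma>) \<phi>s)"

definition substs :: "'f language \<Rightarrow> (nat \<Rightarrow> 'f form) set" where
  "substs L = {\<sigma>. \<forall>x. \<sigma> x \<in> fm L}"

text \<open>The restriction to variables of the composite of two substitutions.\<close>

definition subst_comp :: "(nat \<Rightarrow> 'f form) \<Rightarrow> (nat \<Rightarrow> 'f form) \<Rightarrow> (nat \<Rightarrow> 'f form)" where
  "subst_comp \<sigma>1 \<sigma>2 = (\<lambda>x. subst \<sigma>1 (\<sigma>2 x))"

definition subst_quantale :: "'f language \<Rightarrow> (nat \<Rightarrow> 'f form) set quantale" where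
  "subst_quantale L =
     \<lparr>carrier = Pow (substs L), eq = (=), le = (\<subseteq>), Join = Union,
      qmult = (\<lambda>\<Sigma>1 \<Sigma>2. {subst_comp \<sigma>1 \<sigma>2 | \<sigma>1 \<sigma>2. \<sigma>1 \<in> \<Sigma>1 \<and> \<sigma>2 \<in> \<Sigma>2}),
      qone = {Var}\<rparr>"


section \<open>Deductive systems on sequents\<close>

type_synonym 'f sequent = "'f form list \<times> 'f form list"

definition stype :: "'f sequent \<Rightarrow> nat \<times> nat" where
  "stype s = (length (fst s), length (snd s))"

definition sequents :: "'f language \<Rightarrow> 'f sequent set" where
  "sequents L = {s. set (fst s) \<subseteq> fm L \<and> set (snd s) \<subseteq> fm L \<and> stype s \<noteq> (0, 0)}"

definition ssubst :: "(nat \<Rightarrow> 'f form) \<Rightarrow> 'f sequent \<Rightarrow> 'f sequent" where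
  "ssubst \<sigma> s = (map (subst \<sigma>) (fst s), map (subst \<sigma>) (snd s))"

definition star :: "(nat \<Rightarrow> 'f form) set \<Rightarrow> 'f sequent set \<Rightarrow> 'f sequent set" where
  "star \<Sigma> \<Phi> = {ssubst \<sigma> \<phi> | \<sigma> \<phi>. \<sigma> \<in> \<Sigma> \<and> \<phi> \<in> \<Phi>}"

definition closed_under_type :: "'f language \<Rightarrow> 'f sequent set \<Rightarrow> bool" where
  "closed_under_type L D \<longleftrightarrow>
     D \<subseteq> sequents L \<and> (\<forall>s\<in>D. \<forall>t\<in>sequents L. stype t = stype s \<longrightarrow> t \<in> D)"

record 'f ded_system =
  lang :: "'f language"
  seqs :: "'f sequent set"
  entails :: "'f sequent set \<Rightarrow> 'f sequent set \<Rightarrow> bool"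

locale deductive_system =
  fixes S :: "'f ded_system"
  assumes seqs_closed: "closed_under_type (lang S) (seqs S)"
    and entails_on: "entails S \<Phi> \<Psi> \<Longrightarrow> \<Phi> \<subseteq> seqs S \<and> \<Psi> \<subseteq> seqs S"
    and entails_subset: "\<lbrakk>\<Phi> \<subseteq> seqs S; \<Psi> \<subseteq> \<Phi>\<rbrakk> \<Longrightarrow> entails S \<Phi> \<Psi>"
    and entails_trans: "\<lbrakk>entails S \<Phi> \<Psi>; entails S \<Psi> \<Xi>\<rbrakk> \<Longrightarrow> entails S \<Phi> \<Xi>"
    and entails_Union: "\<Phi> \<subseteq> seqs S \<Longrightarrow> entails S \<Phi> (\<Union>{\<Psi>. entails S \<Phi> \<Psi>})"
    and entails_finitary:
      "\<lbrakk>entails S \<Phi> \<Psi>; finite \<Psi>\<rbrakk> \<Longrightarrow> \<exists>\<Phi>0. finite \<Phi>0 \<and> \<Phi>0 \<subseteq> \<Phi> \<and> entails S \<Phi>0 \<Psi>"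
    and entails_subst:
      "\<lbrakk>entails S \<Phi> \<Psi>; \<sigma> \<in> substs (lang S)\<rbrakk> \<Longrightarrow> entails S (ssubst \<sigma> ` \<Phi>) (ssubst \<sigma> ` \<Psi>)"

definition ded_closure :: "'f ded_system \<Rightarrow> 'f sequent set \<Rightarrow> 'f sequent set" where
  "ded_closure S \<Phi> = \<Union>{\<Psi>. entails S \<Phi> \<Psi>}"

definition theory_module :: "'f ded_system \<Rightarrow> ((nat \<Rightarrow> 'f form) set, 'f sequent set) qmodule" where
  "theory_module S =
     \<lparr>carrier = {ded_closure S \<Phi> | \<Phi>. \<Phi> \<subseteq> seqs S}, eq = (=), le = (\<subseteq>),
      Join = (\<lambda>X. ded_closure S (\<Union>X)),
      act = (\<lambda>\<Sigma> \<Phi>. ded_closure S (star \<Sigma> \<Phi>))\<rparr>"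


section \<open>Translations and interpretations\<close>

text \<open>The formula \<open>\<phi>\<close> has all its variables among the distinct variables \<open>xs\<close>, so the induced
  operation is determined on argument lists of length \<open>n\<close>; its value elsewhere is irrelevant.\<close>

definition derived_connective :: "'g language \<Rightarrow> nat \<Rightarrow> ('g form list \<Rightarrow> 'g form) \<Rightarrow> bool" where
  "derived_connective L n d \<longleftrightarrow>
     (\<exists>\<phi>\<in>fm L. \<exists>xs. distinct xs \<and> length xs = n \<and> vars \<phi> \<subseteq> set xs \<and>
        (\<forall>\<psi>s. length \<psi>s = n \<and> set \<psi>s \<subseteq> fm L \<longrightarrow>
           d \<psi>s = subst (\<lambda>x. case map_of (zip xs \<psi>s) x of None \<Rightarrow> Var x | Some \<psi> \<Rightarrow> \<psi>) \<phi>))"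

definition language_translation :: "'f language \<Rightarrow> 'g language \<Rightarrow> ('f form \<Rightarrow> 'g form) \<Rightarrow> bool" where
  "language_translation L L' \<tau> \<longleftrightarrow>
     \<tau> \<in> fm L \<rightarrow> fm L' \<and>
     (\<forall>x. {\<phi> \<in> fm L. \<tau> \<phi> = Var x} = {Var x}) \<and>
     (\<exists>d. (\<forall>f\<in>conns L. derived_connective L' (arity L f) (d f)) \<and>
          (\<forall>f\<in>conns L. \<forall>\<phi>s. length \<phi>s = arity L f \<and> set \<phi>s \<subseteq> fm L \<longrightarrow>
             \<tau> (App f \<phi>s) = d f (map \<tau> \<phi>s)))"

definition translate_substs ::
    "('f form \<Rightarrow> 'g form) \<Rightarrow> (nat \<Rightarrow> 'f form) set \<Rightarrow> (nat \<Rightarrow> 'g form) set" where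
  "translate_substs \<tau> \<Sigma> = (\<lambda>\<sigma>. \<tau> \<circ> \<sigma>) ` \<Sigma>"

definition nonconservative_interpretation ::
    "'f ded_system \<Rightarrow> 'g ded_system \<Rightarrow> ('f sequent set \<Rightarrow> 'g sequent set) \<Rightarrow> bool" where
  "nonconservative_interpretation S T \<iota> \<longleftrightarrow>
     \<iota> \<in> Pow (seqs S) \<rightarrow> Pow (seqs T) \<and>
     (\<forall>X. X \<subseteq> Pow (seqs S) \<longrightarrow> \<iota> (\<Union>X) = \<Union>(\<iota> ` X)) \<and>
     (\<exists>\<tau>. language_translation (lang S) (lang T) \<tau> \<and>
        (\<forall>\<Phi> \<Psi>. \<Phi> \<subseteq> seqs S \<and> \<Psi> \<subseteq> seqs S \<longrightarrow>
           entails S \<Phi> \<Psi> \<longrightarrow> entails T (\<iota> \<Phi>) (\<iota> \<Psi>)) \<and>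
        (\<forall>\<Sigma> \<Phi>. \<Sigma> \<subseteq> substs (lang S) \<and> \<Phi> \<subseteq> seqs S \<longrightarrow>
           \<iota> (star \<Sigma> \<Phi>) = star (translate_substs \<tau> \<Sigma>) (\<iota> \<Phi>)))"

end

theory Submission
  imports Defs
begin

text \<open>A language translation \<open>\<tau>\<close> satisfies
  \<open>\<tau> (\<sigma> \<phi>) = (\<tau> \<circ> \<sigma>) (\<tau> \<phi>)\<close>, because the value of a derived connective commutes with
  substitutions; hence \<open>\<sigma> \<mapsto> \<tau> \<circ> \<sigma>\<close> is a monoid homomorphism and its elementwise extension a
  quantale homomorphism. If \<open>\<iota>\<close> is an interpretation, then \<open>f \<Phi> = \<delta> (\<iota> \<Phi>)\<close> is a module
  homomorphism: \<open>\<iota>\<close> commutes with unions and scalars, preservation of entailment gives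
  \<open>\<delta> (\<iota> (\<gamma> \<Phi>)) = \<delta> (\<iota> \<Phi>)\<close>, and \<open>\<delta>\<close> is structural.\<close>

section \<open>Sup-lattices and restriction of scalars\<close>

text \<open>Serves both concrete lattices, sets of substitutions and theories, which are ordered by
  inclusion and have explicit joins. Infima come for free as joins of lower bounds.\<close>

lemma sup_lattice_inclusion:
  fixes L :: "('a set, 'b) join_order_scheme"
  assumes eq: "eq L = (=)" and le: "le L = (\<subseteq>)"
    and closed: "\<And>X. X \<subseteq> carrier L \<Longrightarrow> Join L X \<in> carrier L"
    and upper: "\<And>X x. \<lbrakk>X \<subseteq> carrier L; x \<in> X\<rbrakk> \<Longrightarrow> x \<subseteq> Join L X"
    and least: "\<And>X y. \<lbrakk>X \<subseteq> carrier L; y \<in> carrier L; \<forall>x\<in>X. x \<subseteq> y\<rbrakk> \<Longrightarrow> Join L X \<subseteq> y"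
  shows "sup_lattice L"
proof -
  \<comment> \<open>\<open>Upper\<close> and \<open>Lower\<close> only look at elements of
    \<open>X\<close> inside the carrier; for \<open>X\<close> contained in the carrier this
    restriction disappears.\<close>
  have Upper: "y \<in> Upper L X \<longleftrightarrow> y \<in> carrier L \<and> (\<forall>x\<in>X. x \<subseteq> y)"
    and Lower: "y \<in> Lower L X \<longleftrightarrow> y \<in> carrier L \<and> (\<forall>x\<in>X. y \<subseteq> x)"
    if "X \<subseteq> carrier L" for X y
    using that by (auto simp: Upper_def Lower_def le)
  have lub: "is_lub L (Join L X) X" if X: "X \<subseteq> carrier L" for X
    unfolding least_def
  proof (intro conjI ballI)
    show "Join L X \<in> Upper L X"
      using closed [OF X] upper [OF X] by (simp add: Upper [OF X])
    show "le L (Join L X) y" if "y \<in> Upper L X" for y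
      using that least [OF X] by (simp add: Upper [OF X] le)
  qed simp
  \<comment> \<open>Every element of \<open>X\<close> is an upper bound of \<open>Lower L X\<close>,
    so leastness puts the join of the lower bounds below it.\<close>
  have glb: "is_glb L (Join L (Lower L X)) X" if X: "X \<subseteq> carrier L" for X
    unfolding greatest_def
  proof (intro conjI ballI)
    have sub: "Lower L X \<subseteq> carrier L"
      by simp
    have "Join L (Lower L X) \<subseteq> x" if "x \<in> X" for x
      by (rule least [OF sub]) (use that X Lower [OF X] in blast)+
    then show "Join L (Lower L X) \<in> Lower L X"
      using closed [OF sub] by (simp add: Lower [OF X])
    show "le L y (Join L (Lower L X))" if "y \<in> Lower L X" for y
      using that upper [OF sub] by (simp add: le)
  qed simp
  have "partial_order L"
    by unfold_locales (auto simp: eq le)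
  then show ?thesis
    using lub glb
    unfolding sup_lattice_def sup_lattice_axioms_def complete_lattice_def complete_lattice_axioms_def
    by blast
qed

text \<open>Each module law for a scalar \<open>q\<close> is the law of \<open>N\<close> for
  \<open>h q\<close>, once \<open>h\<close> is moved through joins, products and the unit.\<close>

lemma quantale_module_restrict_scalars:
  assumes "quantale_hom Q R h" and "quantale_module R N"
  shows "quantale_module Q (restrict_scalars h N)"
proof -
  interpret h: quantale_hom Q R h by fact
  interpret N: quantale_module R N by fact
  have sel: "carrier (restrict_scalars h N) = carrier N" "eq (restrict_scalars h N) = (=)"
    "le (restrict_scalars h N) = le N" "Join (restrict_scalars h N) = Join N"
    by (simp_all add: restrict_scalars_def N.eq_is_equal)
  \<comment> \<open>Changing the scalars changes the type of the record, so the order notions are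
    carried over by unfolding; they depend only on the carrier and the order.\<close>
  have bounds: "least (restrict_scalars h N) = least N" "greatest (restrict_scalars h N) = greatest N"
    "Upper (restrict_scalars h N) = Upper N" "Lower (restrict_scalars h N) = Lower N"
    by (simp_all add: fun_eq_iff least_def greatest_def Upper_def Lower_def sel)
  have lat: "sup_lattice (restrict_scalars h N)"
    by unfold_locales
      (auto simp: sel bounds N.sup_exists N.inf_exists N.Join_lub
        intro: N.le_antisym N.le_trans)
  have h: "h q \<in> carrier R" if "q \<in> carrier Q" for q
    using that h.hom_closed by blast
  have h_image: "h ` A \<subseteq> carrier R" if "A \<subseteq> carrier Q" for A
    using that h by blast
  have "quantale_module_axioms Q (restrict_scalars h N)"
    unfolding quantale_module_axioms_def
    by (simp add: restrict_scalars_def h h_image h.hom_qone h.hom_qmult h.hom_Join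
        N.act_closed N.act_qone N.act_qmult N.act_Join_left N.act_Join_right image_image)
  then show ?thesis
    using lat h.dom.quantale_axioms by (simp add: quantale_module_def)
qed

section \<open>Substitutions\<close>

lemma subst_in_fm:
  assumes "\<phi> \<in> fm L" and "\<sigma> \<in> substs L"
  shows "subst \<sigma> \<phi> \<in> fm L"
  using assms(1)
proof induction
  case (fm_Var x)
  then show ?case
    using assms(2) by (simp add: substs_def)
next
  case (fm_App f \<phi>s)
  then show ?case
    by (auto intro!: fm.fm_App)
qed

lemma subst_Var: "subst Var \<phi> = \<phi>"
  by (induction \<phi>) (auto intro: map_idI)

lemma subst_cong: "(\<And>x. x \<in> vars \<phi> \<Longrightarrow> \<sigma> x = \<sigma>' x) \<Longrightarrow> subst \<sigma> \<phi> = subst \<sigma>' \<phi>"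
  by (induction \<phi>) auto

text \<open>\<open>subst_comp\<close> records a composite only by its values on variables; this
  justifies treating it as composition on all formulas, and associativity follows from it.\<close>

lemma subst_subst_comp: "subst (subst_comp \<sigma>1 \<sigma>2) \<phi> = subst \<sigma>1 (subst \<sigma>2 \<phi>)"
  by (induction \<phi>) (auto simp: subst_comp_def)

lemma subst_comp_Var_left: "subst_comp Var \<sigma> = \<sigma>"
  by (simp add: subst_comp_def subst_Var)

lemma subst_comp_Var_right: "subst_comp \<sigma> Var = \<sigma>"
  by (simp add: subst_comp_def)

lemma subst_comp_assoc:
  "subst_comp (subst_comp \<sigma>1 \<sigma>2) \<sigma>3 = subst_comp \<sigma>1 (subst_comp \<sigma>2 \<sigma>3)"
  by (simp add: subst_comp_def subst_subst_comp [unfolded subst_comp_def])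

lemma Var_in_substs: "Var \<in> substs L"
  by (simp add: substs_def fm_Var)

lemma subst_comp_in_substs:
  "\<lbrakk>\<sigma>1 \<in> substs L; \<sigma>2 \<in> substs L\<rbrakk> \<Longrightarrow> subst_comp \<sigma>1 \<sigma>2 \<in> substs L"
  using subst_in_fm unfolding substs_def subst_comp_def by blast

text \<open>The powerset of a monoid: the monoid laws lift elementwise, and an elementwise product
  distributes over unions.\<close>

lemma quantale_subst_quantale: "quantale (subst_quantale L)"
proof -
  have "sup_lattice (subst_quantale L)"
    by (rule sup_lattice_inclusion) (auto simp: subst_quantale_def)
  moreover have "quantale_axioms (subst_quantale L)"
  proof (rule quantale_axioms.intro)
    let ?M = "\<lparr>carrier = carrier (subst_quantale L), mult = qmult (subst_quantale L),
      one = qone (subst_quantale L)\<rparr>"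
    show "Group.monoid ?M"
    proof
      fix A B C
      assume "A \<in> carrier ?M" "B \<in> carrier ?M"
      then show "mult ?M A B \<in> carrier ?M"
        by (auto simp: subst_quantale_def intro!: subst_comp_in_substs)
      show "mult ?M (mult ?M A B) C = mult ?M A (mult ?M B C)"
        by (auto simp: subst_quantale_def) (metis subst_comp_assoc)+
    qed (auto simp: subst_quantale_def Var_in_substs subst_comp_Var_left subst_comp_Var_right)
  qed (simp_all add: subst_quantale_def, blast+)
  ultimately show ?thesis
    by (rule quantale.intro)
qed

section \<open>The action of substitutions on sequents\<close>

lemma ssubst_Var: "ssubst Var s = s"
  by (simp add: ssubst_def subst_Var map_idI)

lemma ssubst_subst_comp: "ssubst (subst_comp \<sigma>1 \<sigma>2) s = ssubst \<sigma>1 (ssubst \<sigma>2 s)"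
  by (simp add: ssubst_def subst_subst_comp)

lemma ssubst_in_sequents:
  "\<lbrakk>s \<in> sequents L; \<sigma> \<in> substs L\<rbrakk> \<Longrightarrow> ssubst \<sigma> s \<in> sequents L"
  using subst_in_fm by (fastforce simp: sequents_def ssubst_def stype_def)

text \<open>Substitution leaves the lengths of both sides of a sequent unchanged, hence its type, so
  a domain closed under type is stable under the action.\<close>

lemma ssubst_closed_under_type:
  assumes "closed_under_type L D" and "s \<in> D" and "\<sigma> \<in> substs L"
  shows "ssubst \<sigma> s \<in> D"
proof -
  have "ssubst \<sigma> s \<in> sequents L"
    using assms ssubst_in_sequents unfolding closed_under_type_def by blast
  moreover have "stype (ssubst \<sigma> s) = stype s"
    by (simp add: stype_def ssubst_def)
  ultimately show ?thesis
    using assms unfolding closed_under_type_def by blast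
qed

lemma star_mono: "\<lbrakk>\<Sigma> \<subseteq> \<Sigma>'; \<Phi> \<subseteq> \<Phi>'\<rbrakk> \<Longrightarrow> star \<Sigma> \<Phi> \<subseteq> star \<Sigma>' \<Phi>'"
  unfolding star_def by blast

lemma star_Var: "star {Var} \<Phi> = \<Phi>"
  by (simp add: star_def ssubst_Var)

text \<open>The set on the left is the complex product of the substitution quantale, so this is the
  associativity law of the action before closing.\<close>

lemma star_star:
  "star {subst_comp \<sigma>1 \<sigma>2 | \<sigma>1 \<sigma>2. \<sigma>1 \<in> \<Sigma>1 \<and> \<sigma>2 \<in> \<Sigma>2} \<Phi> = star \<Sigma>1 (star \<Sigma>2 \<Phi>)"
  (is "star ?\<Sigma> \<Phi> = _")
proof (intro equalityI subsetI)
  fix s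
  assume "s \<in> star ?\<Sigma> \<Phi>"
  then obtain \<sigma>1 \<sigma>2 \<phi> where "\<sigma>1 \<in> \<Sigma>1" "\<sigma>2 \<in> \<Sigma>2" "\<phi> \<in> \<Phi>"
    and "s = ssubst (subst_comp \<sigma>1 \<sigma>2) \<phi>"
    unfolding star_def by blast
  then show "s \<in> star \<Sigma>1 (star \<Sigma>2 \<Phi>)"
    unfolding star_def ssubst_subst_comp by blast
next
  fix s
  assume "s \<in> star \<Sigma>1 (star \<Sigma>2 \<Phi>)"
  then obtain \<sigma>1 \<sigma>2 \<phi> where "\<sigma>1 \<in> \<Sigma>1" "\<sigma>2 \<in> \<Sigma>2" "\<phi> \<in> \<Phi>"
    and "s = ssubst (subst_comp \<sigma>1 \<sigma>2) \<phi>"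
    unfolding star_def ssubst_subst_comp by blast
  then show "s \<in> star ?\<Sigma> \<Phi>"
    unfolding star_def by blast
qed

lemma star_Union_left: "star (\<Union>A) \<Phi> = (\<Union>\<Sigma>\<in>A. star \<Sigma> \<Phi>)"
  unfolding star_def by blast

lemma star_Union_right: "star \<Sigma> (\<Union>X) = (\<Union>\<Phi>\<in>X. star \<Sigma> \<Phi>)"
  unfolding star_def by blast

section \<open>The module of theories\<close>

context deductive_system
begin

abbreviation cl :: "'f sequent set \<Rightarrow> 'f sequent set" where
  "cl \<equiv> ded_closure S"

lemma closure_subset_seqs: "cl \<Phi> \<subseteq> seqs S"
  using entails_on unfolding ded_closure_def by blast

text \<open>The dictionary between consequence relation and closure operator. From right to left,
  \<open>entails_Union\<close> derives the whole closure, and transitivity passes to its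
  subset.\<close>

lemma entails_iff_subset_closure:
  assumes "\<Phi> \<subseteq> seqs S"
  shows "entails S \<Phi> \<Psi> \<longleftrightarrow> \<Psi> \<subseteq> cl \<Phi>"
proof
  show "\<Psi> \<subseteq> cl \<Phi>" if "entails S \<Phi> \<Psi>"
    using that unfolding ded_closure_def by blast
  show "entails S \<Phi> \<Psi>" if "\<Psi> \<subseteq> cl \<Phi>"
    using that assms entails_Union entails_subset entails_trans closure_subset_seqs
    unfolding ded_closure_def by meson
qed

lemma closure_extensive: "\<Phi> \<subseteq> seqs S \<Longrightarrow> \<Phi> \<subseteq> cl \<Phi>"
  using entails_iff_subset_closure entails_subset by blast

text \<open>By transitivity: \<Psi> entails \<Phi>, which entails \<open>cl \<Phi>\<close>.
  Monotonicity and the equality criterion for closures below rest on this.\<close>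

lemma closure_least:
  assumes "\<Psi> \<subseteq> seqs S" and "\<Phi> \<subseteq> cl \<Psi>"
  shows "cl \<Phi> \<subseteq> cl \<Psi>"
proof -
  have "\<Phi> \<subseteq> seqs S"
    using assms closure_subset_seqs by blast
  then show ?thesis
    using assms entails_iff_subset_closure entails_trans by (meson order_refl)
qed

lemma closure_mono: "\<lbrakk>\<Psi> \<subseteq> seqs S; \<Phi> \<subseteq> \<Psi>\<rbrakk> \<Longrightarrow> cl \<Phi> \<subseteq> cl \<Psi>"
  using closure_least closure_extensive by blast

lemma closure_eqI:
  "\<lbrakk>\<Phi> \<subseteq> seqs S; \<Psi> \<subseteq> seqs S; \<Phi> \<subseteq> cl \<Psi>; \<Psi> \<subseteq> cl \<Phi>\<rbrakk> \<Longrightarrow> cl \<Phi> = cl \<Psi>"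
  using closure_least by blast

lemma closure_idem: "\<Phi> \<subseteq> seqs S \<Longrightarrow> cl (cl \<Phi>) = cl \<Phi>"
  using closure_extensive [of \<Phi>] closure_extensive [of "cl \<Phi>"] closure_subset_seqs [of \<Phi>]
  by (intro closure_eqI) auto

text \<open>Joins of theories may be computed on generators. This gives both distributivity laws of
  the theory module and, later, preservation of joins by the homomorphism.\<close>

lemma closure_UN_closure:
  assumes "\<And>i. i \<in> I \<Longrightarrow> \<Phi> i \<subseteq> seqs S"
  shows "cl (\<Union>i\<in>I. cl (\<Phi> i)) = cl (\<Union>i\<in>I. \<Phi> i)"
proof (rule closure_eqI)
  show U: "(\<Union>i\<in>I. \<Phi> i) \<subseteq> seqs S" and V: "(\<Union>i\<in>I. cl (\<Phi> i)) \<subseteq> seqs S"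
    using assms closure_subset_seqs by blast+
  show "(\<Union>i\<in>I. cl (\<Phi> i)) \<subseteq> cl (\<Union>i\<in>I. \<Phi> i)"
    using closure_mono [OF U] by blast
  show "(\<Union>i\<in>I. \<Phi> i) \<subseteq> cl (\<Union>i\<in>I. cl (\<Phi> i))"
    using assms closure_extensive [OF V] closure_extensive by blast
qed

section \<open>The action on theories\<close>

lemma star_subset_seqs:
  "\<lbrakk>\<Sigma> \<subseteq> substs (lang S); \<Phi> \<subseteq> seqs S\<rbrakk> \<Longrightarrow> star \<Sigma> \<Phi> \<subseteq> seqs S"
  using ssubst_closed_under_type [OF seqs_closed] unfolding star_def by blast

text \<open>Substitution invariance handles one \<sigma> at a time; since \<open>star\<close> is the
  union of the images under the members of \<Sigma>, monotonicity of the closure does the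
  rest.\<close>

lemma star_closure_subset:
  assumes "\<Sigma> \<subseteq> substs (lang S)" and "\<Phi> \<subseteq> seqs S"
  shows "star \<Sigma> (cl \<Phi>) \<subseteq> cl (star \<Sigma> \<Phi>)"
proof
  fix s
  assume "s \<in> star \<Sigma> (cl \<Phi>)"
  then obtain \<sigma> where \<sigma>: "\<sigma> \<in> \<Sigma>" "s \<in> ssubst \<sigma> ` cl \<Phi>"
    unfolding star_def by blast
  have "entails S (ssubst \<sigma> ` \<Phi>) (ssubst \<sigma> ` cl \<Phi>)"
    using assms \<sigma> entails_subst entails_iff_subset_closure by blast
  then have "ssubst \<sigma> ` cl \<Phi> \<subseteq> cl (ssubst \<sigma> ` \<Phi>)"
    unfolding ded_closure_def by blast
  moreover have sub: "ssubst \<sigma> ` \<Phi> \<subseteq> star \<Sigma> \<Phi>"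
    using \<sigma> unfolding star_def by blast
  ultimately show "s \<in> cl (star \<Sigma> \<Phi>)"
    using \<sigma> closure_mono [OF star_subset_seqs [OF assms] sub] by blast
qed

lemma closure_star_closure:
  assumes "\<Sigma> \<subseteq> substs (lang S)" and "\<Phi> \<subseteq> seqs S"
  shows "cl (star \<Sigma> (cl \<Phi>)) = cl (star \<Sigma> \<Phi>)"
proof (rule closure_eqI)
  show "star \<Sigma> (cl \<Phi>) \<subseteq> seqs S" and "star \<Sigma> \<Phi> \<subseteq> seqs S"
    using assms star_subset_seqs closure_subset_seqs by blast+
  then show "star \<Sigma> \<Phi> \<subseteq> cl (star \<Sigma> (cl \<Phi>))"
    using star_mono [OF order_refl closure_extensive [OF assms(2)]] closure_extensive by blast
qed (rule star_closure_subset [OF assms])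

lemma carrier_theory_module:
  "\<Phi> \<in> carrier (theory_module S) \<longleftrightarrow> \<Phi> \<subseteq> seqs S \<and> cl \<Phi> = \<Phi>"
proof
  assume "\<Phi> \<in> carrier (theory_module S)"
  then obtain \<Psi> where "\<Psi> \<subseteq> seqs S" "\<Phi> = cl \<Psi>"
    by (auto simp: theory_module_def)
  then show "\<Phi> \<subseteq> seqs S \<and> cl \<Phi> = \<Phi>"
    by (simp add: closure_idem closure_subset_seqs)
next
  assume "\<Phi> \<subseteq> seqs S \<and> cl \<Phi> = \<Phi>"
  then show "\<Phi> \<in> carrier (theory_module S)"
    by (auto simp: theory_module_def intro!: exI [of _ \<Phi>])
qed

lemma closure_in_carrier: "\<Phi> \<subseteq> seqs S \<Longrightarrow> cl \<Phi> \<in> carrier (theory_module S)"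
  by (auto simp: theory_module_def)

lemma Union_subset_seqs: "X \<subseteq> carrier (theory_module S) \<Longrightarrow> \<Union>X \<subseteq> seqs S"
  using carrier_theory_module by blast

text \<open>Each law is the corresponding law of \<open>star\<close> on arbitrary sets of sequents,
  followed by the removal of inner closures; the unit law uses that theories are fixed by
  \<open>cl\<close>.\<close>

lemma quantale_module_theory_module:
  "quantale_module (subst_quantale (lang S)) (theory_module S)"
proof -
  let ?M = "theory_module S"
  have Join: "Join ?M X = cl (\<Union>X)" and act: "act ?M \<Sigma> \<Phi> = cl (star \<Sigma> \<Phi>)" for X \<Sigma> \<Phi>
    by (simp_all add: theory_module_def)
  have "sup_lattice ?M"
  proof (rule sup_lattice_inclusion)
    show "eq ?M = (=)" and "le ?M = (\<subseteq>)"
      by (simp_all add: theory_module_def)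
    fix X
    assume X: "X \<subseteq> carrier ?M"
    show "Join ?M X \<in> carrier ?M"
      using Union_subset_seqs [OF X] by (simp add: Join closure_in_carrier)
    show "x \<subseteq> Join ?M X" if "x \<in> X" for x
      using that closure_extensive [OF Union_subset_seqs [OF X]] by (auto simp: Join)
    \<comment> \<open>Since \<open>y\<close> is its own closure, closing a union contained in
      \<open>y\<close> does not leave \<open>y\<close>.\<close>
    show "Join ?M X \<subseteq> y" if "y \<in> carrier ?M" "\<forall>x\<in>X. x \<subseteq> y" for y
      using that closure_mono [of y "\<Union>X"] by (auto simp: Join carrier_theory_module)
  qed
  moreover have "quantale_module_axioms (subst_quantale (lang S)) ?M"
  proof
    fix P Q \<Phi>
    assume Q: "Q \<in> carrier (subst_quantale (lang S))" and \<Phi>: "\<Phi> \<in> carrier ?M"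
    have Q': "Q \<subseteq> substs (lang S)" and \<Phi>': "\<Phi> \<subseteq> seqs S" "cl \<Phi> = \<Phi>"
      using Q \<Phi> by (auto simp: subst_quantale_def carrier_theory_module)
    show "act ?M Q \<Phi> \<in> carrier ?M"
      using Q' \<Phi>' by (simp add: act closure_in_carrier star_subset_seqs)
    show "act ?M (qmult (subst_quantale (lang S)) P Q) \<Phi> = act ?M P (act ?M Q \<Phi>)"
      if "P \<in> carrier (subst_quantale (lang S))"
      using that Q' \<Phi>'
      by (simp add: act subst_quantale_def star_star closure_star_closure star_subset_seqs)
  next
    fix \<Phi>
    assume "\<Phi> \<in> carrier ?M"
    then show "act ?M (qone (subst_quantale (lang S))) \<Phi> = \<Phi>"
      by (simp add: act subst_quantale_def star_Var carrier_theory_module)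
  next
    fix A \<Phi>
    assume "A \<subseteq> carrier (subst_quantale (lang S))" "\<Phi> \<in> carrier ?M"
    then have "star \<Sigma> \<Phi> \<subseteq> seqs S" if "\<Sigma> \<in> A" for \<Sigma>
      using that by (intro star_subset_seqs) (auto simp: subst_quantale_def carrier_theory_module)
    then show "act ?M (Join (subst_quantale (lang S)) A) \<Phi> = Join ?M ((\<lambda>\<Sigma>. act ?M \<Sigma> \<Phi>) ` A)"
      by (simp add: act Join star_Union_left closure_UN_closure subst_quantale_def)
  next
    fix \<Sigma> X
    assume "\<Sigma> \<in> carrier (subst_quantale (lang S))" and X: "X \<subseteq> carrier ?M"
    then have \<Sigma>: "\<Sigma> \<subseteq> substs (lang S)"
      by (simp add: subst_quantale_def)
    then have "star \<Sigma> \<Phi> \<subseteq> seqs S" if "\<Phi> \<in> X" for \<Phi>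
      using that X by (intro star_subset_seqs) (auto dest!: Union_subset_seqs)
    then show "act ?M \<Sigma> (Join ?M X) = Join ?M (act ?M \<Sigma> ` X)"
      using closure_star_closure [OF \<Sigma> Union_subset_seqs [OF X]]
      by (simp add: act Join star_Union_right closure_UN_closure)
  qed
  ultimately show ?thesis
    using quantale_subst_quantale by (simp add: quantale_module_def)
qed

end

section \<open>Translations\<close>

lemma language_translation_Var: "language_translation L L' \<tau> \<Longrightarrow> \<tau> (Var x) = Var x"
  unfolding language_translation_def by blast

lemma language_translation_in_fm: "\<lbrakk>language_translation L L' \<tau>; \<phi> \<in> fm L\<rbrakk> \<Longrightarrow> \<tau> \<phi> \<in> fm L'"
  unfolding language_translation_def by blast

lemma language_translation_comp_substs:
  "\<lbrakk>language_translation L L' \<tau>; \<sigma> \<in> substs L\<rbrakk> \<Longrightarrow> \<tau> \<circ> \<sigma> \<in> substs L'"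
  by (simp add: substs_def language_translation_in_fm)

lemma translate_substs_subset:
  assumes "language_translation L L' \<tau>" and "\<Sigma> \<subseteq> substs L"
  shows "translate_substs \<tau> \<Sigma> \<subseteq> substs L'"
  using language_translation_comp_substs [OF assms(1)] assms(2)
  unfolding translate_substs_def by blast

text \<open>Filling the argument places of \<phi> and then applying \<sigma> amounts to filling them
  with the images under \<sigma>, because \<phi> has no variables besides those in
  \<open>xs\<close>.\<close>

lemma derived_connective_subst:
  assumes d: "derived_connective L n d"
    and len: "length \<psi>s = n" and \<psi>s: "set \<psi>s \<subseteq> fm L" and \<sigma>: "\<sigma> \<in> substs L"
  shows "subst \<sigma> (d \<psi>s) = d (map (subst \<sigma>) \<psi>s)"
proof -
  let ?s = "\<lambda>xs \<psi>s x. case map_of (zip xs \<psi>s) x of None \<Rightarrow> Var x | Some \<psi> \<Rightarrow> \<psi>"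
  obtain \<phi> xs where xs: "length xs = n" "vars \<phi> \<subseteq> set xs"
    and d_eq: "\<And>\<psi>s. \<lbrakk>length \<psi>s = n; set \<psi>s \<subseteq> fm L\<rbrakk> \<Longrightarrow> d \<psi>s = subst (?s xs \<psi>s) \<phi>"
    using d unfolding derived_connective_def by blast
  \<comment> \<open>Outside \<open>xs\<close> the default branch yields \<open>\<sigma> x\<close> on
    the left but \<open>Var x\<close> on the right, so agreement is claimed on the variables of
    \<phi> only.\<close>
  have "subst_comp \<sigma> (?s xs \<psi>s) x = ?s xs (map (subst \<sigma>) \<psi>s) x" if "x \<in> vars \<phi>" for x
  proof -
    have "x \<in> set xs"
      using that xs by blast
    then obtain \<psi> where "map_of (zip xs \<psi>s) x = Some \<psi>"
      using len xs by (metis map_of_zip_is_Some)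
    then show ?thesis
      by (simp add: subst_comp_def zip_map2 map_of_map)
  qed
  then have "subst \<sigma> (subst (?s xs \<psi>s) \<phi>) = subst (?s xs (map (subst \<sigma>) \<psi>s)) \<phi>"
    unfolding subst_subst_comp [symmetric] by (rule subst_cong)
  moreover have "set (map (subst \<sigma>) \<psi>s) \<subseteq> fm L"
    using \<psi>s \<sigma> subst_in_fm by auto
  ultimately show ?thesis
    using d_eq len \<psi>s by simp
qed

lemma language_translation_subst:
  assumes \<tau>: "language_translation L L' \<tau>" and \<sigma>: "\<sigma> \<in> substs L" and \<phi>: "\<phi> \<in> fm L"
  shows "\<tau> (subst \<sigma> \<phi>) = subst (\<tau> \<circ> \<sigma>) (\<tau> \<phi>)"
  using \<phi>
proof induction
  case (fm_Var x)
  then show ?case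
    by (simp add: language_translation_Var [OF \<tau>])
next
  case (fm_App f \<phi>s)
  obtain d where d: "derived_connective L' (arity L f) d"
    and \<tau>_App: "\<And>\<phi>s. \<lbrakk>length \<phi>s = arity L f; set \<phi>s \<subseteq> fm L\<rbrakk> \<Longrightarrow> \<tau> (App f \<phi>s) = d (map \<tau> \<phi>s)"
    using \<tau> \<open>f \<in> conns L\<close> unfolding language_translation_def by blast
  have \<phi>s: "set \<phi>s \<subseteq> fm L"
    using fm_App by blast
  then have "set (map (subst \<sigma>) \<phi>s) \<subseteq> fm L" and \<tau>\<phi>s: "set (map \<tau> \<phi>s) \<subseteq> fm L'"
    using \<sigma> subst_in_fm language_translation_in_fm [OF \<tau>] by auto
  then have "\<tau> (subst \<sigma> (App f \<phi>s)) = d (map \<tau> (map (subst \<sigma>) \<phi>s))"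
    using fm_App(2) \<tau>_App [of "map (subst \<sigma>) \<phi>s"] by simp
  also have "map \<tau> (map (subst \<sigma>) \<phi>s) = map (subst (\<tau> \<circ> \<sigma>)) (map \<tau> \<phi>s)"
    using fm_App.IH by (simp add: o_def)
  \<comment> \<open>Here the derived connective is natural for \<tau> composed with \<sigma>, a
    substitution over the target language.\<close>
  also have "d \<dots> = subst (\<tau> \<circ> \<sigma>) (d (map \<tau> \<phi>s))"
    using derived_connective_subst [OF d _ \<tau>\<phi>s language_translation_comp_substs [OF \<tau> \<sigma>]]
      fm_App(2) by simp
  also have "d (map \<tau> \<phi>s) = \<tau> (App f \<phi>s)"
    using \<tau>_App fm_App(2) \<phi>s by simp
  finally show ?case .
qed

lemma quantale_hom_translate_substs:
  assumes \<tau>: "language_translation L L' \<tau>"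
  shows "quantale_hom (subst_quantale L) (subst_quantale L') (translate_substs \<tau>)"
proof -
  \<comment> \<open>At a variable \<open>x\<close> this is \<open>language_translation_subst\<close>
    applied to the formula \<open>\<sigma>2 x\<close>.\<close>
  have comp: "\<tau> \<circ> subst_comp \<sigma>1 \<sigma>2 = subst_comp (\<tau> \<circ> \<sigma>1) (\<tau> \<circ> \<sigma>2)"
    if "\<sigma>1 \<in> substs L" "\<sigma>2 \<in> substs L" for \<sigma>1 \<sigma>2
    using that language_translation_subst [OF \<tau>]
    by (simp add: fun_eq_iff subst_comp_def substs_def)
  have "quantale_hom_axioms (subst_quantale L) (subst_quantale L') (translate_substs \<tau>)"
  proof
    show "translate_substs \<tau> \<in> carrier (subst_quantale L) \<rightarrow> carrier (subst_quantale L')"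
      by (simp add: subst_quantale_def translate_substs_subset [OF \<tau>])
    show "translate_substs \<tau> (Join (subst_quantale L) A)
        = Join (subst_quantale L') (translate_substs \<tau> ` A)" for A
      by (auto simp: subst_quantale_def translate_substs_def)
    show "translate_substs \<tau> (qone (subst_quantale L)) = qone (subst_quantale L')"
      by (simp add: subst_quantale_def translate_substs_def fun_eq_iff
          language_translation_Var [OF \<tau>])
    fix P Q
    assume "P \<in> carrier (subst_quantale L)" "Q \<in> carrier (subst_quantale L)"
    then have sub: "P \<subseteq> substs L" "Q \<subseteq> substs L"
      by (auto simp: subst_quantale_def)
    have "translate_substs \<tau> (qmult (subst_quantale L) P Q)
        = {\<tau> \<circ> subst_comp \<sigma>1 \<sigma>2 | \<sigma>1 \<sigma>2. \<sigma>1 \<in> P \<and> \<sigma>2 \<in> Q}"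
      by (auto simp: subst_quantale_def translate_substs_def)
    also have "\<dots> = {subst_comp (\<tau> \<circ> \<sigma>1) (\<tau> \<circ> \<sigma>2) | \<sigma>1 \<sigma>2. \<sigma>1 \<in> P \<and> \<sigma>2 \<in> Q}"
      \<comment> \<open>\<open>comp\<close> is available only for substitutions over
        \<open>L\<close>, so the congruence rule has to supply membership in \<open>P\<close> and
        \<open>Q\<close> while rewriting the witness equation.\<close>
      using sub by (intro Collect_cong ex_cong1 rev_conj_cong) (auto simp: comp subset_iff)
    also have "\<dots> = qmult (subst_quantale L') (translate_substs \<tau> P) (translate_substs \<tau> Q)"
      by (auto simp: subst_quantale_def translate_substs_def)
    finally show "translate_substs \<tau> (qmult (subst_quantale L) P Q)
        = qmult (subst_quantale L') (translate_substs \<tau> P) (translate_substs \<tau> Q)" .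
  qed
  then show ?thesis
    by (simp add: quantale_hom_def quantale_subst_quantale)
qed

text \<open>The conjunct about \<tau> makes \<open>h\<close> the map induced by a language
  translation, not just some quantale homomorphism.\<close>

theorem theorem5p5p10:
  fixes S :: "'f ded_system" and T :: "'g ded_system"
  assumes "deductive_system S" and "deductive_system T"
    and "\<exists>\<iota>. nonconservative_interpretation S T \<iota>"
  shows "\<exists>h f.
    (\<exists>\<tau>. language_translation (lang S) (lang T) \<tau> \<and> h = translate_substs \<tau>) \<and>
    quantale_hom (subst_quantale (lang S)) (subst_quantale (lang T)) h \<and>
    quantale_module_hom (subst_quantale (lang S))
      (theory_module S) (restrict_scalars h (theory_module T)) f"
proof -
  interpret S: deductive_system S by fact
  interpret T: deductive_system T by fact
  obtain \<iota> where \<iota>: "nonconservative_interpretation S T \<iota>"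
    using assms(3) ..
  then obtain \<tau> where \<tau>: "language_translation (lang S) (lang T) \<tau>"
    and \<iota>_imp: "\<forall>\<Phi> \<Psi>. \<Phi> \<subseteq> seqs S \<and> \<Psi> \<subseteq> seqs S \<longrightarrow>
      entails S \<Phi> \<Psi> \<longrightarrow> entails T (\<iota> \<Phi>) (\<iota> \<Psi>)"
    and \<iota>_star: "\<forall>\<Sigma> \<Phi>. \<Sigma> \<subseteq> substs (lang S) \<and> \<Phi> \<subseteq> seqs S \<longrightarrow>
      \<iota> (star \<Sigma> \<Phi>) = star (translate_substs \<tau> \<Sigma>) (\<iota> \<Phi>)"
    unfolding nonconservative_interpretation_def by (elim conjE exE)
  have \<iota>_entails: "entails T (\<iota> \<Phi>) (\<iota> \<Psi>)" if "entails S \<Phi> \<Psi>" for \<Phi> \<Psi>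
    using that \<iota>_imp S.entails_on by simp
  have \<iota>_seqs: "\<iota> \<Phi> \<subseteq> seqs T" if "\<Phi> \<subseteq> seqs S" for \<Phi>
    using \<iota> that by (simp add: nonconservative_interpretation_def Pi_iff)
  have \<iota>_Union: "\<iota> (\<Union>X) = \<Union>(\<iota> ` X)" if "X \<subseteq> Pow (seqs S)" for X
    using \<iota> that unfolding nonconservative_interpretation_def by simp
  let ?h = "translate_substs \<tau>"
  let ?M = "theory_module S"
  let ?N = "restrict_scalars ?h (theory_module T)"
  let ?f = "\<lambda>\<Phi>. T.cl (\<iota> \<Phi>)"
  have hom: "quantale_hom (subst_quantale (lang S)) (subst_quantale (lang T)) ?h"
    by (rule quantale_hom_translate_substs [OF \<tau>])
  \<comment> \<open>\<Phi> and its closure entail each other, and \<iota> preserves both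
    entailments, so their images generate the same theory. Hence \<open>?f\<close> can be evaluated
    on generators in the join and scalar laws.\<close>
  have f_closure: "?f (S.cl \<Phi>) = ?f \<Phi>" if \<Phi>: "\<Phi> \<subseteq> seqs S" for \<Phi>
  proof -
    have "entails T (\<iota> \<Phi>) (\<iota> (S.cl \<Phi>))" "entails T (\<iota> (S.cl \<Phi>)) (\<iota> \<Phi>)"
      using \<Phi> S.closure_extensive S.closure_subset_seqs S.entails_subset
        S.entails_iff_subset_closure by (simp_all add: \<iota>_entails)
    then show ?thesis
      by (meson T.closure_eqI T.entails_iff_subset_closure T.entails_on)
  qed
  have "quantale_module_hom_axioms (subst_quantale (lang S)) ?M ?N ?f"
  proof
    show "?f \<in> carrier ?M \<rightarrow> carrier ?N"
      using \<iota>_seqs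
      by (auto simp: restrict_scalars_def S.carrier_theory_module T.closure_in_carrier)
  next
    fix X
    assume X: "X \<subseteq> carrier ?M"
    then have sub: "X \<subseteq> Pow (seqs S)"
      using S.carrier_theory_module by blast
    have "?f (Join ?M X) = ?f (\<Union>X)"
      using f_closure [OF S.Union_subset_seqs [OF X]] by (simp add: theory_module_def)
    \<comment> \<open>\<iota> distributes over the union, after which each image may be closed
      separately inside the outer closure.\<close>
    also have "\<dots> = T.cl (\<Union>\<Phi>\<in>X. ?f \<Phi>)"
      unfolding \<iota>_Union [OF sub] by (rule T.closure_UN_closure [symmetric]) (use sub \<iota>_seqs in blast)
    finally show "?f (Join ?M X) = Join ?N (?f ` X)"
      by (simp add: restrict_scalars_def theory_module_def)
  next
    fix \<Sigma> \<Phi>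
    assume \<Sigma>Q: "\<Sigma> \<in> carrier (subst_quantale (lang S))" and "\<Phi> \<in> carrier ?M"
    then have \<Sigma>: "\<Sigma> \<subseteq> substs (lang S)" and \<Phi>: "\<Phi> \<subseteq> seqs S"
      by (simp_all add: subst_quantale_def S.carrier_theory_module)
    have h\<Sigma>: "?h \<Sigma> \<subseteq> substs (lang T)"
      by (rule translate_substs_subset [OF \<tau> \<Sigma>])
    have "?f (act ?M \<Sigma> \<Phi>) = ?f (star \<Sigma> \<Phi>)"
      using f_closure [OF S.star_subset_seqs [OF \<Sigma> \<Phi>]] by (simp add: theory_module_def)
    \<comment> \<open>\<iota> turns the scalar \<Sigma> into \<open>?h \<Sigma>\<close>; the closure
      inside \<open>?f \<Phi>\<close> is then absorbed by the outer one.\<close>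
    also have "\<dots> = T.cl (star (?h \<Sigma>) (?f \<Phi>))"
      using \<iota>_star \<Sigma> \<Phi> T.closure_star_closure [OF h\<Sigma> \<iota>_seqs [OF \<Phi>]] by simp
    finally show "?f (act ?M \<Sigma> \<Phi>) = act ?N \<Sigma> (?f \<Phi>)"
      by (simp add: restrict_scalars_def theory_module_def)
  qed
  then have "quantale_module_hom (subst_quantale (lang S)) ?M ?N ?f"
    using S.quantale_module_theory_module
      quantale_module_restrict_scalars [OF hom T.quantale_module_theory_module]
    by (simp add: quantale_module_hom_def)
  then show ?thesis
    using \<tau> hom by blast
qed

end
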